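(* Let $\mathcal D_0$ be an invariant class of diffeomorphisms of $\overline\Omega$, let $\mathcal U\subset W^{1,p}(\Omega;\mathbb R^m)$ be a collection of maps invariant under $\mathcal D_0$, let $I:\mathcal U\to\mathbb R$ be a functional, and let $I_i$ be its invariant realization with respect to $\mathcal D_0$. Then $$\inf_{u\in\mathcal U}I(u)=\inf_{u\in\mathcal U}I_i(u).$$ Moreover, if the infimum of $I$ over $\mathcal U$ is attained at some $u_0\in\mathcal U$, i.e. $$\inf_{u\in\mathcal U}I(u)=\min_{u\in\mathcal U}I(u)=I(u_0),$$ then $u_0$ is also a minimizer of $I_i$ over $\mathcal U$: $$I_i(u_0)=\min_{u\in\mathcal U}I_i(u).$$
   Context: Let $N<m$ be positive integers, $p\ge 1$, and let $\Omega\subset\mathbb R^N$ be a model domain such as the unit ball or the unit square (cube). $\mathcal D=\mathcal D(\Omega)$ is the class of all smooth ($C^\infty$), positively oriented diffeomorphisms $\Phi$ of $\overline\Omega$ onto itself, and $\mathcal D_{\mathrm{id}}$ is the subclass of those equal to the identity on $\partial\Omega$. An invariant class is a subclass $\mathcal D_0$ with $\mathcal D_{\mathrm{id}}\subset\mathcal D_0\subset\mathcal D$ such that $\Phi_1\circ\Phi_2\in\mathcal D_0$ whenever $\Phi_1,\Phi_2\in\mathcal D_0$. For a map $u$ on $\Omega$ and $\Phi\in\mathcal D$ put $u_\Phi(x)=u(\Phi^{-1}(x))$. A collection $\mathcal U\subset W^{1,p}(\Omega;\mathbb R^m)$ is invariant under $\mathcal D_0$ if $u_\Phi\in\mathcal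 U$ whenever $u\in\mathcal U$ and $\Phi\in\mathcal D_0$. Functionals are arbitrary; they need not be integral functionals. The invariant realization of $I$ with respect to $\mathcal D_0$ is $$I_i(u)=\inf_{\Phi\in\mathcal D_0}I(u_\Phi),\quad u\in\mathcal U.$$ *)

theory Defs
  imports "HOL-Analysis.Analysis"
begin

text \<open>The model domains: nonempty bounded domains that fill the interior of their closure. The
  last condition excludes slits and punctures, so that a homeomorphism of the closure onto itself
  maps the domain onto itself.\<close>

definition model_domain :: "'a::euclidean_space set \<Rightarrow> bool" where
  "model_domain \<Omega> \<longleftrightarrow>
     open \<Omega> \<and> connected \<Omega> \<and> bounded \<Omega> \<and> \<Omega> \<noteq> {} \<and> interior (closure \<Omega>) = \<Omega>"

lemma model_domain_convex:
  fixes \<Omega> :: "'a::euclidean_space set"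
  assumes "open \<Omega>" "convex \<Omega>" "bounded \<Omega>" "\<Omega> \<noteq> {}"
  shows "model_domain \<Omega>"
  using assms
  by (simp add: model_domain_def convex_connected convex_interior_closure interior_open)

lemma model_domain_unit_ball: "model_domain (ball (0::'a::euclidean_space) 1)"
  by (rule model_domain_convex) auto

lemma model_domain_unit_cube: "model_domain (box (0::'a::euclidean_space) One)"
  by (rule model_domain_convex) (auto simp: box_eq_empty intro: convex_box bounded_box)

text \<open>Smoothness on an open set \<open>S\<close>: the iterated directional derivatives of every order
  exist and are continuous on \<open>S\<close>.\<close>

fun Ck_on :: "nat \<Rightarrow> 'a::real_normed_vector set \<Rightarrow> ('a \<Rightarrow> 'b::real_normed_vector) \<Rightarrow> bool" where
  "Ck_on 0 S f \<longleftrightarrow> continuous_on S f"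
| "Ck_on (Suc k) S f \<longleftrightarrow>
     (\<forall>x\<in>S. f differentiable (at x)) \<and>
     (\<forall>v. Ck_on k S (\<lambda>x. frechet_derivative f (at x) v))"

definition smooth_on :: "'a::real_normed_vector set \<Rightarrow> ('a \<Rightarrow> 'b::real_normed_vector) \<Rightarrow> bool" where
  "smooth_on S f \<longleftrightarrow> (\<forall>k. Ck_on k S f)"

text \<open>Smoothness up to the boundary, i.e. on \<open>closure \<Omega>\<close>: there is a smooth extension to an
  open neighbourhood.\<close>

definition smooth_on_closure ::
    "'a::real_normed_vector set \<Rightarrow> ('a \<Rightarrow> 'b::real_normed_vector) \<Rightarrow> bool" where
  "smooth_on_closure \<Omega> f \<longleftrightarrow>
     (\<exists>T g. open T \<and> closure \<Omega> \<subseteq> T \<and> smooth_on T g \<and> (\<forall>x\<in>closure \<Omega>. g x = f x))"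

text \<open>A map of \<open>closure \<Omega>\<close> onto itself is represented by its unique total extension that is the
  identity off \<open>closure \<Omega>\<close> (this is what \<open>permutes\<close> says); then \<open>inv \<Phi>\<close> represents the inverse
  map. The identity off \<open>closure \<Omega>\<close> is only a convention: the extension need not even be
  continuous across the boundary. The sign of the Jacobian is prescribed inside \<open>\<Omega>\<close>; it follows
  on the boundary, where the Jacobian is nonzero by smoothness of the inverse.\<close>

definition diffeos :: "(real^'n) set \<Rightarrow> (real^'n \<Rightarrow> real^'n) set" where
  "diffeos \<Omega> = {\<Phi>. \<Phi> permutes closure \<Omega> \<and>
     smooth_on_closure \<Omega> \<Phi> \<and> smooth_on_closure \<Omega> (inv \<Phi>) \<and>
     (\<forall>x\<in>\<Omega>. det (matrix (frechet_derivative \<Phi> (at x))) > 0)}"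

definition diffeos_id :: "(real^'n) set \<Rightarrow> (real^'n \<Rightarrow> real^'n) set" where
  "diffeos_id \<Omega> = {\<Phi> \<in> diffeos \<Omega>. \<forall>x\<in>frontier \<Omega>. \<Phi> x = x}"

definition invariant_class :: "(real^'n) set \<Rightarrow> (real^'n \<Rightarrow> real^'n) set \<Rightarrow> bool" where
  "invariant_class \<Omega> D\<^sub>0 \<longleftrightarrow>
     diffeos_id \<Omega> \<subseteq> D\<^sub>0 \<and> D\<^sub>0 \<subseteq> diffeos \<Omega> \<and> (\<forall>\<Phi>\<^sub>1\<in>D\<^sub>0. \<forall>\<Phi>\<^sub>2\<in>D\<^sub>0. \<Phi>\<^sub>1 \<circ> \<Phi>\<^sub>2 \<in> D\<^sub>0)"

definition test_function :: "(real^'n) set \<Rightarrow> (real^'n \<Rightarrow> real) \<Rightarrow> bool" where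
  "test_function \<Omega> \<phi> \<longleftrightarrow>
     smooth_on UNIV \<phi> \<and> compact (closure {x. \<phi> x \<noteq> 0}) \<and> closure {x. \<phi> x \<noteq> 0} \<subseteq> \<Omega>"

definition Lp_function :: "(real^'n) set \<Rightarrow> real \<Rightarrow> (real^'n \<Rightarrow> real^'m) \<Rightarrow> bool" where
  "Lp_function \<Omega> p u \<longleftrightarrow>
     u \<in> borel_measurable (lebesgue_on \<Omega>) \<and>
     integrable (lebesgue_on \<Omega>) (\<lambda>x. norm (u x) powr p)"

definition weak_partial ::
    "(real^'n) set \<Rightarrow> 'n \<Rightarrow> (real^'n \<Rightarrow> real^'m) \<Rightarrow> (real^'n \<Rightarrow> real^'m) \<Rightarrow> bool" where
  "weak_partial \<Omega> i u g \<longleftrightarrow>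
     (\<forall>\<phi>. test_function \<Omega> \<phi> \<longrightarrow>
        (\<integral>x. frechet_derivative \<phi> (at x) (axis i 1) *\<^sub>R u x \<partial>lebesgue_on \<Omega>) =
        - (\<integral>x. \<phi> x *\<^sub>R g x \<partial>lebesgue_on \<Omega>))"

definition W1p_function :: "(real^'n) set \<Rightarrow> real \<Rightarrow> (real^'n \<Rightarrow> real^'m) \<Rightarrow> bool" where
  "W1p_function \<Omega> p u \<longleftrightarrow>
     Lp_function \<Omega> p u \<and> (\<forall>i. \<exists>g. Lp_function \<Omega> p g \<and> weak_partial \<Omega> i u g)"

text \<open>Elements of the Sobolev space are classes of functions modulo equality almost everywhere
  on \<open>\<Omega>\<close>. In particular the values of a representative off \<open>\<Omega>\<close> are irrelevant.\<close>

definition ae_eq :: "(real^'n) set \<Rightarrow> ((real^'n \<Rightarrow> real^'m) \<times> (real^'n \<Rightarrow> real^'m)) set" where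
  "ae_eq \<Omega> = {(u, v). AE x in lebesgue_on \<Omega>. u x = v x}"

lemma equiv_ae_eq: "equiv UNIV (ae_eq \<Omega>)"
  by (rule equivI) (auto simp: ae_eq_def refl_on_def sym_def trans_def elim: eventually_elim2 eventually_mono)

definition W1p :: "(real^'n) set \<Rightarrow> real \<Rightarrow> (real^'n \<Rightarrow> real^'m) set set" where
  "W1p \<Omega> p = {u. W1p_function \<Omega> p u} // ae_eq \<Omega>"

text \<open>The class \<open>u\<^sub>\<Phi>\<close> of the maps \<open>w \<circ> \<Phi>\<inverse>\<close>, where \<open>w\<close> is any representative of \<open>u\<close>.\<close>

definition transport ::
    "(real^'n) set \<Rightarrow> (real^'n \<Rightarrow> real^'n) \<Rightarrow> (real^'n \<Rightarrow> real^'m) set \<Rightarrow> (real^'n \<Rightarrow> real^'m) set" where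
  "transport \<Omega> \<Phi> u = ae_eq \<Omega> `` ((\<lambda>w. w \<circ> inv \<Phi>) ` u)"

definition invariant_under ::
    "(real^'n) set \<Rightarrow> (real^'n \<Rightarrow> real^'n) set \<Rightarrow> (real^'n \<Rightarrow> real^'m) set set \<Rightarrow> bool" where
  "invariant_under \<Omega> D\<^sub>0 U \<longleftrightarrow> (\<forall>u\<in>U. \<forall>\<Phi>\<in>D\<^sub>0. transport \<Omega> \<Phi> u \<in> U)"

text \<open>Infima are taken in the extended reals, since the functional need not be bounded below.\<close>

definition invariant_realization ::
    "(real^'n) set \<Rightarrow> (real^'n \<Rightarrow> real^'n) set \<Rightarrow> ((real^'n \<Rightarrow> real^'m) set \<Rightarrow> real) \<Rightarrow>
      (real^'n \<Rightarrow> real^'m) set \<Rightarrow> ereal" where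
  "invariant_realization \<Omega> D\<^sub>0 I u = (INF \<Phi>\<in>D\<^sub>0. ereal (I (transport \<Omega> \<Phi> u)))"

end

theory Submission
  imports Defs
begin

text \<open>Both infima range over the same values of \<open>I\<close>. Transporting a map never leaves \<open>U\<close>, so
  every competitor \<open>I (transport \<Omega> \<Phi> u)\<close> in the definition of the invariant realization
  already competes in the infimum of \<open>I\<close> over \<open>U\<close>
  (\<open>INF_le_invariant_realization\<close>). Conversely the identity belongs to every
  invariant class and transports each map to itself, so the realization lies below \<open>I\<close>
  (\<open>invariant_realization_le\<close>). At a minimizer \<open>u\<^sub>0\<close> of \<open>I\<close> the two bounds
  squeeze the realization to the common infimum.

  The analytic content is confined to the identity: it is smooth up to the boundary with Jacobian
  one, and transport along it fixes an element of the Sobolev space because such an element is a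
  whole class modulo equality almost everywhere.\<close>

lemma Ck_on_const: "Ck_on k S (\<lambda>x. c)"
  by (induction k arbitrary: c) (auto simp: frechet_derivative_const)

lemma smooth_on_id: "smooth_on S (id :: 'a::real_normed_vector \<Rightarrow> 'a)"
  unfolding smooth_on_def
proof
  fix k
  show "Ck_on k S (id :: 'a \<Rightarrow> 'a)"
    by (cases k) (auto simp: continuous_on_id' frechet_derivative_id id_def Ck_on_const)
qed

lemma id_in_diffeos_id: "id \<in> diffeos_id (\<Omega> :: (real^'n) set)"
proof -
  have "smooth_on_closure \<Omega> (id :: real^'n \<Rightarrow> real^'n)"
    unfolding smooth_on_closure_def using smooth_on_id open_UNIV by blast
  moreover have "det (matrix (frechet_derivative (id :: real^'n \<Rightarrow> real^'n) (at x))) > 0" for x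
    by (simp add: frechet_derivative_id id_def[symmetric] matrix_id_mat_1)
  ultimately show ?thesis
    by (simp add: diffeos_id_def diffeos_def permutes_id)
qed

text \<open>By definition a transport is saturated with respect to equality almost everywhere, so it
  returns the given set only if that set is saturated too. Being an equivalence class provides
  this.\<close>

lemma transport_id:
  assumes "u \<in> W1p \<Omega> p"
  shows "transport \<Omega> id u = u"
proof -
  obtain w where "u = ae_eq \<Omega> `` {w}"
    using assms by (auto simp: W1p_def elim: quotientE)
  then have "ae_eq \<Omega> `` u = u"
    using equiv_ae_eq[of \<Omega>] by (fastforce simp: equiv_def refl_on_def dest: transD)
  then show ?thesis
    by (simp add: transport_def)
qed

lemma invariant_realization_le:
  assumes "invariant_class \<Omega> D\<^sub>0" and "u \<in> W1p \<Omega> p"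
  shows "invariant_realization \<Omega> D\<^sub>0 I u \<le> ereal (I u)"
proof -
  have "id \<in> D\<^sub>0"
    using assms(1) id_in_diffeos_id by (auto simp: invariant_class_def)
  then show ?thesis
    unfolding invariant_realization_def
    by (rule INF_lower2) (simp add: transport_id[OF assms(2)])
qed

lemma INF_le_invariant_realization:
  assumes "invariant_under \<Omega> D\<^sub>0 U" and "u \<in> U"
  shows "(INF v\<in>U. ereal (I v)) \<le> invariant_realization \<Omega> D\<^sub>0 I u"
  unfolding invariant_realization_def
  using assms by (intro INF_greatest INF_lower) (auto simp: invariant_under_def)

theorem proposition2p4:
  fixes \<Omega> :: "(real^'n) set"
    and p :: real
    and D\<^sub>0 :: "(real^'n \<Rightarrow> real^'n) set"
    and U :: "(real^'n \<Rightarrow> real^'m) set set"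
    and I :: "(real^'n \<Rightarrow> real^'m) set \<Rightarrow> real"
  assumes "CARD('n) < CARD('m)"
    and "1 \<le> p"
    and "model_domain \<Omega>"
    and "invariant_class \<Omega> D\<^sub>0"
    and "U \<subseteq> W1p \<Omega> p"
    and "invariant_under \<Omega> D\<^sub>0 U"
  shows "(INF u\<in>U. ereal (I u)) = (INF u\<in>U. invariant_realization \<Omega> D\<^sub>0 I u) \<and>
    (\<forall>u\<^sub>0\<in>U. (INF u\<in>U. ereal (I u)) = ereal (I u\<^sub>0) \<longrightarrow>
      invariant_realization \<Omega> D\<^sub>0 I u\<^sub>0 = (INF u\<in>U. invariant_realization \<Omega> D\<^sub>0 I u))"
proof -
  have below: "invariant_realization \<Omega> D\<^sub>0 I u \<le> ereal (I u)" if "u \<in> U" for u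
    using invariant_realization_le assms(4,5) that by blast
  have inf_eq: "(INF u\<in>U. ereal (I u)) = (INF u\<in>U. invariant_realization \<Omega> D\<^sub>0 I u)"
  proof (rule antisym)
    show "(INF u\<in>U. ereal (I u)) \<le> (INF u\<in>U. invariant_realization \<Omega> D\<^sub>0 I u)"
      by (intro INF_greatest INF_le_invariant_realization assms(6))
    show "(INF u\<in>U. invariant_realization \<Omega> D\<^sub>0 I u) \<le> (INF u\<in>U. ereal (I u))"
      using below by (intro INF_mono) blast
  qed
  moreover have "invariant_realization \<Omega> D\<^sub>0 I u\<^sub>0 = (INF u\<in>U. invariant_realization \<Omega> D\<^sub>0 I u)"
    if "u\<^sub>0 \<in> U" and "(INF u\<in>U. ereal (I u)) = ereal (I u\<^sub>0)" for u\<^sub>0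
    using below[OF that(1)] INF_le_invariant_realization[OF assms(6) that(1), of I] that(2) inf_eq
    by simp
  ultimately show ?thesis
    by blast
qed

end
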